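(* Let $K$ be a field and $A$ a finite dimensional symmetric cellular $K$-algebra with cell datum $(\Lambda,M,C,i)$, with a fixed symmetrizing trace $\tau$ and dual basis $\{D_{S,T}^{\lambda}\}$. Then the following are equivalent: (1) The algebra $A$ is semisimple. (2) $k_\lambda\neq0$ for all $\lambda\in\Lambda$. (3) $\{C_{S,T}^{\lambda}D_{T,T}^{\lambda}\mid\lambda\in\Lambda,\ S,T\in M(\lambda)\}$ is a basis of $A$. (4) For any $\lambda\in\Lambda$, there exist $S,T\in M(\lambda)$ such that $(C_{S,T}^{\lambda}D_{T,S}^{\lambda})^{2}\neq0$. (5) For any $\lambda\in\Lambda$ and arbitrary $S,T\in M(\lambda)$, $(C_{S,T}^{\lambda}D_{T,S}^{\lambda})^{2}\neq0$.
   Context: Cellular algebra (Goodman's version). An associative unital $K$-algebra $A$ is cellular with cell datum $(\Lambda, M, C, i)$ if: (C1) $\Lambda$ is a finite poset; to each $\lambda\in\Lambda$ is attached a finite (nonempty) set $M(\lambda)$; $A$ has a $K$-basis $\{C_{S,T}^{\lambda}\mid S,T\in M(\lambda),\lambda\in\Lambda\}$. (C2) $i$ is a $K$-linear anti-automorphism of $A$ with $i^2=\mathrm{id}$ and $i(C_{S,T}^{\lambda})\equiv C_{T,S}^{\lambda} \pmod{A(<\lambda)}$, where $A(<\lambda)$ is the $K$-span of $\{C_{S'',T''}^{\mu}\mid S'',T''\in M(\mu),\mu<\lambda\}$. (C3) For $a\in A$, $aC_{S,T}^{\lambda}\equiv\sum_{S'\in M(\lambda)}r_a(S',S)C_{S',T}^{\lambda}\pmod{A(<\lambda)}$,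 where $r_a(S',S)\in K$ is independent of $T$. Symmetric algebra. A finite dimensional $K$-algebra $A$ is symmetric if it carries a non-degenerate associative ($f(ab,c)=f(a,bc)$) symmetric bilinear form $f$; $\tau(a)=f(a,1)$ is called a symmetrizing trace. A symmetric cellular algebra is both symmetric and cellular. Dual basis. $\{D_{S,T}^{\lambda}\}$ is the basis with $\tau(C_{S,T}^{\lambda}D_{U,V}^{\mu})=\delta_{\lambda\mu}\delta_{SV}\delta_{TU}$. It is again a cellular basis for the opposite order on $\Lambda$. Constants $k_\lambda$. For $S,T,U,V\in M(\lambda)$, scalars $\Phi(T,U),\Psi(T,U)$, depending only on $T,U$, are defined by $C_{S,T}^{\lambda}C_{U,V}^{\lambda}\equiv\Phi(T,U)C_{S,V}^{\lambda}\pmod{A(<\lambda)}$ and $D_{S,T}^{\lambda}D_{U,V}^{\lambda}\equiv\Psi(T,U)D_{S,V}^{\lambda}\pmod{A_D(>\lambda)}$, where $A_D(>\lambda)$ is the span of all $D_{X,Y}^{\mu}$ with $\mu>\lambda$. Then $k_\lambda=\sum_{X\in M(\lambda)}\Phi(X,V)\Psi(X,V)$ for an arbitrary $V\in M(\lambda)$; this does not depend on $V$. *)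

theory Defs
  imports Complex_Main "HOL-Library.FuncSet"
begin

text \<open>
  The underlying ring has sort \<open>{ring, monoid_mult}\<close> rather than \<open>ring_1\<close>, so that the zero
  algebra (the case of an empty poset) is not excluded.
\<close>

locale unital_algebra = vector_space scale
  for scale :: "'k::field \<Rightarrow> 'a::{ring,monoid_mult} \<Rightarrow> 'a" +
  assumes scale_mult_left: "scale c a * b = scale c (a * b)"
    and scale_mult_right: "a * scale c b = scale c (a * b)"

definition basis_family ::
  "('k::field \<Rightarrow> 'a::ab_group_add \<Rightarrow> 'a) \<Rightarrow> 'i set \<Rightarrow> ('i \<Rightarrow> 'a) \<Rightarrow> bool"
  where "basis_family scale I b \<longleftrightarrow>
    inj_on b I \<and> \<not> module.dependent scale (b ` I) \<and> module.span scale (b ` I) = UNIV"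

definition cell_basis ::
  "('k::field \<Rightarrow> 'a::ab_group_add \<Rightarrow> 'a) \<Rightarrow> 'l set \<Rightarrow> ('l \<Rightarrow> 'm set) \<Rightarrow>
    ('l \<Rightarrow> 'm \<Rightarrow> 'm \<Rightarrow> 'a) \<Rightarrow> bool"
  where "cell_basis scale \<Lambda> M B \<longleftrightarrow>
    basis_family scale (SIGMA l:\<Lambda>. M l \<times> M l) (\<lambda>(l, S, T). B l S T)"

text \<open>
  The partial order on \<open>\<Lambda>\<close> is a relation \<open>r\<close>, where \<open>(m, l) \<in> r\<close> means \<open>m \<le> l\<close>.
  \<open>cell_below scale \<Lambda> r M C l\<close> is \<open>A(<l)\<close>; the space \<open>A\<^sub>D(>l)\<close> is obtained from the same
  definition with the opposite order, as \<open>cell_below scale \<Lambda> (r\<inverse>) M D l\<close>.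
\<close>

definition cell_below ::
  "('k::field \<Rightarrow> 'a::ab_group_add \<Rightarrow> 'a) \<Rightarrow> 'l set \<Rightarrow> ('l \<times> 'l) set \<Rightarrow> ('l \<Rightarrow> 'm set) \<Rightarrow>
    ('l \<Rightarrow> 'm \<Rightarrow> 'm \<Rightarrow> 'a) \<Rightarrow> 'l \<Rightarrow> 'a set"
  where "cell_below scale \<Lambda> r M B l = module.span scale
    {B m S T | m S T. m \<in> \<Lambda> \<and> (m, l) \<in> r \<and> m \<noteq> l \<and> S \<in> M m \<and> T \<in> M m}"

locale cellular_algebra = unital_algebra scale
  for scale :: "'k::field \<Rightarrow> 'a::{ring,monoid_mult} \<Rightarrow> 'a" +
  fixes \<Lambda> :: "'l set" and r :: "('l \<times> 'l) set" and M :: "'l \<Rightarrow> 'm set"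
    and C :: "'l \<Rightarrow> 'm \<Rightarrow> 'm \<Rightarrow> 'a" and i :: "'a \<Rightarrow> 'a"
  assumes finite_poset: "finite \<Lambda>" "partial_order_on \<Lambda> r"
    and finite_M: "l \<in> \<Lambda> \<Longrightarrow> finite (M l)"
    and nonempty_M: "l \<in> \<Lambda> \<Longrightarrow> M l \<noteq> {}"
    and basis_C: "cell_basis scale \<Lambda> M C"
    and linear_i: "Vector_Spaces.linear scale scale i"
    and anti_mult_i: "i (a * b) = i b * i a"
    and involution_i: "i (i a) = a"
    and i_C: "\<lbrakk>l \<in> \<Lambda>; S \<in> M l; T \<in> M l\<rbrakk> \<Longrightarrow>
      i (C l S T) - C l T S \<in> cell_below scale \<Lambda> r M C l"
    and mult_C: "l \<in> \<Lambda> \<Longrightarrow> \<exists>\<rho>. \<forall>S\<in>M l. \<forall>T\<in>M l.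
      a * C l S T - (\<Sum>S'\<in>M l. scale (\<rho> S' S) (C l S' T)) \<in> cell_below scale \<Lambda> r M C l"

definition symmetrizing_form ::
  "('k::field \<Rightarrow> 'a::{ring,monoid_mult} \<Rightarrow> 'a) \<Rightarrow> ('a \<Rightarrow> 'a \<Rightarrow> 'k) \<Rightarrow> bool"
  where "symmetrizing_form scale f \<longleftrightarrow>
    (\<forall>b. Vector_Spaces.linear scale (*) (\<lambda>a. f a b)) \<and>
    (\<forall>a. Vector_Spaces.linear scale (*) (\<lambda>b. f a b)) \<and>
    (\<forall>a b c. f (a * b) c = f a (b * c)) \<and>
    (\<forall>a b. f a b = f b a) \<and>
    (\<forall>a. (\<forall>b. f a b = 0) \<longrightarrow> a = 0)"

definition symmetrizing_trace ::
  "('k::field \<Rightarrow> 'a::{ring,monoid_mult} \<Rightarrow> 'a) \<Rightarrow> ('a \<Rightarrow> 'k) \<Rightarrow> bool"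
  where "symmetrizing_trace scale \<tau> \<longleftrightarrow>
    (\<exists>f. symmetrizing_form scale f \<and> (\<forall>a. \<tau> a = f a 1))"

definition dual_cell_basis ::
  "('k::field \<Rightarrow> 'a::{ring,monoid_mult} \<Rightarrow> 'a) \<Rightarrow> ('a \<Rightarrow> 'k) \<Rightarrow> 'l set \<Rightarrow> ('l \<Rightarrow> 'm set) \<Rightarrow>
    ('l \<Rightarrow> 'm \<Rightarrow> 'm \<Rightarrow> 'a) \<Rightarrow> ('l \<Rightarrow> 'm \<Rightarrow> 'm \<Rightarrow> 'a) \<Rightarrow> bool"
  where "dual_cell_basis scale \<tau> \<Lambda> M C D \<longleftrightarrow>
    cell_basis scale \<Lambda> M D \<and>
    (\<forall>l\<in>\<Lambda>. \<forall>m\<in>\<Lambda>. \<forall>S\<in>M l. \<forall>T\<in>M l. \<forall>U\<in>M m. \<forall>V\<in>M m.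
      \<tau> (C l S T * D m U V) = (if l = m \<and> S = V \<and> T = U then 1 else 0))"

text \<open>
  \<open>\<Phi>(T,U)\<close> is \<open>cell_form scale \<Lambda> r M C l T U\<close>, and \<open>\<Psi>(T,U)\<close> is
  \<open>cell_form scale \<Lambda> (r\<inverse>) M D l T U\<close>.
\<close>

definition cell_form ::
  "('k::field \<Rightarrow> 'a::{ring,monoid_mult} \<Rightarrow> 'a) \<Rightarrow> 'l set \<Rightarrow> ('l \<times> 'l) set \<Rightarrow> ('l \<Rightarrow> 'm set) \<Rightarrow>
    ('l \<Rightarrow> 'm \<Rightarrow> 'm \<Rightarrow> 'a) \<Rightarrow> 'l \<Rightarrow> 'm \<Rightarrow> 'm \<Rightarrow> 'k"
  where "cell_form scale \<Lambda> r M B l T U = (THE c. \<forall>S\<in>M l. \<forall>V\<in>M l.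
    B l S T * B l U V - scale c (B l S V) \<in> cell_below scale \<Lambda> r M B l)"

text \<open>
  The sum defining \<open>k\<^sub>l\<close> does not depend on \<open>V\<close>; the definite description
  picks its common value.
\<close>

definition cell_const ::
  "('k::field \<Rightarrow> 'a::{ring,monoid_mult} \<Rightarrow> 'a) \<Rightarrow> 'l set \<Rightarrow> ('l \<times> 'l) set \<Rightarrow> ('l \<Rightarrow> 'm set) \<Rightarrow>
    ('l \<Rightarrow> 'm \<Rightarrow> 'm \<Rightarrow> 'a) \<Rightarrow> ('l \<Rightarrow> 'm \<Rightarrow> 'm \<Rightarrow> 'a) \<Rightarrow> 'l \<Rightarrow> 'k"
  where "cell_const scale \<Lambda> r M C D l = (THE k. \<forall>V\<in>M l.
    k = (\<Sum>X\<in>M l. cell_form scale \<Lambda> r M C l X V * cell_form scale \<Lambda> (r\<inverse>) M D l X V))"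

text \<open>
  Closure under negation and under scalars of an algebra is automatic, since the ring is unital.
\<close>

definition left_ideal :: "'a::{ring,monoid_mult} set \<Rightarrow> bool"
  where "left_ideal L \<longleftrightarrow>
    0 \<in> L \<and> (\<forall>x\<in>L. \<forall>y\<in>L. x + y \<in> L) \<and> (\<forall>a. \<forall>x\<in>L. a * x \<in> L)"

definition minimal_left_ideal :: "'a::{ring,monoid_mult} set \<Rightarrow> bool"
  where "minimal_left_ideal L \<longleftrightarrow>
    left_ideal L \<and> L \<noteq> {0} \<and> (\<forall>L'. left_ideal L' \<and> L' \<subseteq> L \<longrightarrow> L' = {0} \<or> L' = L)"

text \<open>
  The left regular module is the internal direct sum of a family of simple submodules. As the
  ring is unital, such a family is necessarily finite; as the summands are nonzero, they
  are pairwise distinct, so a set of left ideals is as general as an indexed family.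
\<close>

definition semisimple_algebra :: "'a::{ring,monoid_mult} itself \<Rightarrow> bool"
  where "semisimple_algebra _ \<longleftrightarrow>
    (\<exists>I :: 'a set set. finite I \<and> (\<forall>L\<in>I. minimal_left_ideal L) \<and>
      (\<forall>a. \<exists>!x. x \<in> (\<Pi>\<^sub>E L\<in>I. L) \<and> a = (\<Sum>L\<in>I. x L)))"

end

theory Submission
  imports Defs
begin

text \<open>
  Since \<open>C\<close> and \<open>D\<close> are dual bases, \<open>C l S T * D m U V\<close> vanishes unless \<open>m \<le> l\<close>, and
  \<open>C l S T * D l U V\<close> vanishes for \<open>T \<noteq> U\<close> and does not depend on \<open>T\<close> for \<open>T = U\<close>. Hence the elements
  \<open>E l S V = C l S T * D l T V\<close> multiply like matrix units up to a scalar: \<open>E l S V * E l V W\<close> equals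
  \<open>kappa l\<close> times \<open>E l S W\<close> and all other products are \<open>0\<close>. Expanding \<open>\<tau> ((D l T T * C l T T)\<^sup>2)\<close>,
  which is \<open>kappa l\<close>, in the basis \<open>C\<close> and using the symmetry of \<open>\<Phi>\<close> gives \<open>kappa l = k\<^sub>l\<close>.
  If all these scalars are nonzero, the \<open>E l S T\<close> form a basis of scaled matrix units, so the algebra
  is semisimple. If \<open>kappa l = 0\<close>, then \<open>e = E l S S\<close> is nonzero because \<open>\<tau> e = 1\<close>, its products with all
  \<open>E m U V\<close> vanish, and \<open>e A e = 0\<close>, which is impossible in a semisimple ring.
\<close>

section \<open>Semisimple rings\<close>

lemma left_ideal_range_mult: "left_ideal (range (\<lambda>a. a * x))"
  for x :: "'a::{ring,monoid_mult}"
  unfolding left_ideal_def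
proof (intro conjI ballI allI)
  show "0 \<in> range (\<lambda>a. a * x)" by (rule range_eqI[of _ _ 0]) simp
  fix y z a assume y: "y \<in> range (\<lambda>a. a * x)"
  show "a * y \<in> range (\<lambda>a. a * x)" using y by (auto simp: mult.assoc[symmetric])
  assume "z \<in> range (\<lambda>a. a * x)"
  with y show "y + z \<in> range (\<lambda>a. a * x)" by (auto simp: distrib_right[symmetric])
qed

text \<open>
  Writing \<open>1\<close> as a sum of elements of minimal left ideals gives such an ideal \<open>L\<close> and \<open>y \<in> L\<close> with
  \<open>e * y \<noteq> 0\<close>; then \<open>L = A * e * y\<close>, so \<open>y = a * e * y\<close> and \<open>e * y = e * a * e * y\<close>.
\<close>

lemma semisimple_algebra_semiprime:
  fixes e :: "'a::{ring,monoid_mult}"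
  assumes ss: "semisimple_algebra TYPE('a)" and e: "\<And>x. e * x * e = 0"
  shows "e = 0"
proof (rule ccontr)
  assume "e \<noteq> 0"
  obtain I :: "'a set set" where I: "finite I" "\<forall>L\<in>I. minimal_left_ideal L"
    "\<forall>a. \<exists>!x. x \<in> (\<Pi>\<^sub>E L\<in>I. L) \<and> a = (\<Sum>L\<in>I. x L)"
    using ss unfolding semisimple_algebra_def by blast
  obtain x where x: "x \<in> (\<Pi>\<^sub>E L\<in>I. L)" "1 = (\<Sum>L\<in>I. x L)"
    using I(3) by metis
  have "e = (\<Sum>L\<in>I. e * x L)"
    using x(2) by (metis mult.right_neutral sum_distrib_left)
  with \<open>e \<noteq> 0\<close> obtain L where L: "L \<in> I" "e * x L \<noteq> 0"
    by (metis sum.neutral)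
  define y where "y = x L"
  have y: "y \<in> L" using x(1) L(1) unfolding y_def by (auto simp: PiE_iff)
  have min: "left_ideal L" "\<And>L'. left_ideal L' \<Longrightarrow> L' \<subseteq> L \<Longrightarrow> L' = {0} \<or> L' = L"
    using I(2) L(1) unfolding minimal_left_ideal_def by blast+
  define L' where "L' = range (\<lambda>a. a * (e * y))"
  have "left_ideal L'"
    unfolding L'_def by (rule left_ideal_range_mult)
  moreover have "L' \<subseteq> L"
    using min(1) y unfolding left_ideal_def L'_def by blast
  moreover have "e * y \<in> L'"
    unfolding L'_def by (metis mult_1 rangeI)
  moreover have "e * y \<noteq> 0" using L(2) y_def by simp
  ultimately have "L' = L" using min(2) by blast
  then obtain a where "y = a * (e * y)"
    using y unfolding L'_def by auto
  then have "e * y = e * a * e * y"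
    by (metis mult.assoc)
  with e[of a] \<open>e * y \<noteq> 0\<close> show False by simp
qed

text \<open>Right multiplication by \<open>e k\<close> projects the regular module onto the left
  ideal generated by \<open>e k\<close>, so the components of \<open>a\<close> can only be the
  elements \<open>a * e k\<close>.\<close>

lemma semisimple_algebra_idempotents:
  fixes e :: "'j \<Rightarrow> 'a::{ring,monoid_mult}"
  assumes J: "finite J"
    and orth: "\<And>j k. j \<in> J \<Longrightarrow> k \<in> J \<Longrightarrow> e j * e k = (if j = k then e j else 0)"
    and one: "(\<Sum>j\<in>J. e j) = 1"
    and min: "\<And>j. j \<in> J \<Longrightarrow> minimal_left_ideal (range (\<lambda>a. a * e j))"
  shows "semisimple_algebra TYPE('a)"
proof -
  define L where "L j = range (\<lambda>a. a * e j)" for j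
  have L_fix: "x * e k = (if j = k then x else 0)" if "x \<in> L j" "j \<in> J" "k \<in> J" for x j k
    using that orth unfolding L_def by (auto simp: mult.assoc)
  have e_L: "e j \<in> L j" for j
    unfolding L_def by (metis mult_1 rangeI)
  have e_nz: "e j \<noteq> 0" if "j \<in> J" for j
    using min[OF that] unfolding minimal_left_ideal_def by auto
  \<comment> \<open>Semisimplicity is defined with a set of ideals, so different indices must give
    different ideals.\<close>
  have inj: "inj_on L J"
  proof (rule inj_onI)
    fix j k assume *: "j \<in> J" "k \<in> J" "L j = L k"
    then have "e j \<in> L k" using e_L by blast
    then have "e j * e j = (if k = j then e j else 0)" using L_fix * by blast
    then show "j = k" using orth e_nz * by (metis)
  qed
  define J' where "J' K = the_inv_into J L K" for K
  have J': "J' (L j) = j" if "j \<in> J" for j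
    unfolding J'_def using inj that by (rule the_inv_into_f_f)
  have sum_L: "(\<Sum>K\<in>L ` J. x K) = (\<Sum>j\<in>J. x (L j))" for x :: "'a set \<Rightarrow> 'a"
    using inj by (simp add: sum.reindex)
  have "\<exists>!x. x \<in> (\<Pi>\<^sub>E K\<in>L ` J. K) \<and> a = (\<Sum>K\<in>L ` J. x K)" for a
  proof (rule ex1I)
    let ?x = "\<lambda>K\<in>L ` J. a * e (J' K)"
    have "(\<Sum>j\<in>J. ?x (L j)) = (\<Sum>j\<in>J. a * e j)"
      by (rule sum.cong) (auto simp: J')
    also have "\<dots> = a" using one by (simp flip: sum_distrib_left)
    finally have "a = (\<Sum>K\<in>L ` J. ?x K)" by (simp only: sum_L)
    moreover have "?x \<in> (\<Pi>\<^sub>E K\<in>L ` J. K)"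
      by (rule restrict_PiE_iff[THEN iffD2]) (use J' in \<open>auto simp: L_def\<close>)
    ultimately show "?x \<in> (\<Pi>\<^sub>E K\<in>L ` J. K) \<and> a = (\<Sum>K\<in>L ` J. ?x K)" by blast
    fix x assume x: "x \<in> (\<Pi>\<^sub>E K\<in>L ` J. K) \<and> a = (\<Sum>K\<in>L ` J. x K)"
    show "x = ?x"
    proof
      fix K
      show "x K = ?x K"
      proof (cases "K \<in> L ` J")
        case True
        then obtain k where k: "k \<in> J" "K = L k" by blast
        have x_L: "x (L j) \<in> L j" if "j \<in> J" for j
          using x that by (auto simp: PiE_iff)
        \<comment> \<open>Multiplying by \<open>e k\<close> erases every component except the one in
          \<open>L k\<close>; this gives uniqueness.\<close>
        have "a * e k = (\<Sum>j\<in>J. x (L j) * e k)"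
          using x by (simp add: sum_L sum_distrib_right)
        also have "\<dots> = (\<Sum>j\<in>J. if j = k then x (L j) else 0)"
          by (rule sum.cong[OF refl]) (use L_fix[OF x_L] k in auto)
        also have "\<dots> = x (L k)" using J k by simp
        finally show ?thesis using k by (simp add: J')
      next
        case False
        then show ?thesis using x by (auto simp: PiE_iff extensional_def)
      qed
    qed
  qed
  moreover have "\<forall>K\<in>L ` J. minimal_left_ideal K"
    using min unfolding L_def by blast
  ultimately show ?thesis
    unfolding semisimple_algebra_def using J by (intro exI[of _ "L ` J"]) blast
qed

section \<open>Bases\<close>

text \<open>An independent family indexed by the same finite set as a basis has as many members as
  the dimension, so it spans.\<close>

lemma (in vector_space) basis_familyI:
  fixes b c :: "'c \<Rightarrow> 'b"
  assumes fin: "finite I" and b: "basis_family scale I b"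
    and indep: "\<And>u p. (\<Sum>q\<in>I. scale (u q) (c q)) = 0 \<Longrightarrow> p \<in> I \<Longrightarrow> u p = 0"
  shows "basis_family scale I c"
proof -
  have inj: "inj_on c I"
  proof (rule inj_onI, rule ccontr)
    fix p q assume *: "p \<in> I" "q \<in> I" "c p = c q" "p \<noteq> q"
    \<comment> \<open>The coefficients of the relation \<open>c p - c q = 0\<close>, which is
      nontrivial because \<open>p \<noteq> q\<close>.\<close>
    define u :: "'c \<Rightarrow> 'a" where "u x = (if x = p then 1 else 0) - (if x = q then 1 else 0)" for x
    have "(\<Sum>x\<in>I. scale (u x) (c x)) =
        (\<Sum>x\<in>I. if x = p then c x else 0) - (\<Sum>x\<in>I. if x = q then c x else 0)"
      unfolding sum_subtractf[symmetric]
      by (rule sum.cong[OF refl]) (auto simp: u_def scale_left_diff_distrib)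
    also have "\<dots> = 0" using fin * by simp
    finally have "u p = 0" using *(1) by (rule indep)
    then show False using *(4) by (simp add: u_def)
  qed
  have ind: "independent (c ` I)"
  proof (rule independent_if_scalars_zero)
    show "finite (c ` I)" using fin by simp
    fix f x assume "(\<Sum>x\<in>c ` I. scale (f x) x) = 0" "x \<in> c ` I"
    then show "f x = 0"
      using indep[of "f \<circ> c"] inj by (auto simp: sum.reindex)
  qed
  interpret finite_dimensional_vector_space scale "b ` I"
    using b fin unfolding basis_family_def by unfold_locales auto
  have "dim (UNIV :: 'b set) = card (b ` I)"
    using b unfolding basis_family_def by (intro dim_eq_card) auto
  also have "\<dots> = card (c ` I)"
    using b inj by (simp add: basis_family_def card_image)
  finally have "UNIV \<subseteq> span (c ` I)"
    using ind by (intro card_ge_dim_independent) auto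
  then show ?thesis
    using inj ind unfolding basis_family_def by auto
qed

section \<open>Dual pairs of cellular bases\<close>

text \<open>
  By nondegeneracy, the last six assumptions say that the left and the right multiplications are
  cellular with respect to \<open>C\<close>. In this form they are visibly invariant under exchanging \<open>C\<close>
  and \<open>D\<close> and reversing the order.
\<close>

locale dual_cell_bases = unital_algebra scale
  for scale :: "'k::field \<Rightarrow> 'a::{ring,monoid_mult} \<Rightarrow> 'a" +
  fixes \<Lambda> :: "'l set" and r :: "('l \<times> 'l) set" and M :: "'l \<Rightarrow> 'm set"
    and C D :: "'l \<Rightarrow> 'm \<Rightarrow> 'm \<Rightarrow> 'a" and \<tau> :: "'a \<Rightarrow> 'k"
  assumes finite_\<Lambda>: "finite \<Lambda>" and order_r: "partial_order_on \<Lambda> r"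
    and finite_M: "l \<in> \<Lambda> \<Longrightarrow> finite (M l)"
    and nonempty_M: "l \<in> \<Lambda> \<Longrightarrow> M l \<noteq> {}"
    and tau_add: "\<tau> (x + y) = \<tau> x + \<tau> y"
    and tau_scale: "\<tau> (scale c x) = c * \<tau> x"
    and tau_commute: "\<tau> (x * y) = \<tau> (y * x)"
    and tau_dual: "\<lbrakk>l \<in> \<Lambda>; m \<in> \<Lambda>; S \<in> M l; T \<in> M l; U \<in> M m; V \<in> M m\<rbrakk> \<Longrightarrow>
      \<tau> (C l S T * D m U V) = (if l = m \<and> S = V \<and> T = U then 1 else 0)"
    and eq_0_C: "(\<And>l S T. l \<in> \<Lambda> \<Longrightarrow> S \<in> M l \<Longrightarrow> T \<in> M l \<Longrightarrow> \<tau> (x * C l S T) = 0) \<Longrightarrow> x = 0"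
    and eq_0_D: "(\<And>l S T. l \<in> \<Lambda> \<Longrightarrow> S \<in> M l \<Longrightarrow> T \<in> M l \<Longrightarrow> \<tau> (x * D l S T) = 0) \<Longrightarrow> x = 0"
    and CD_order: "\<lbrakk>l \<in> \<Lambda>; m \<in> \<Lambda>; S \<in> M l; T \<in> M l; U \<in> M m; V \<in> M m;
      C l S T * D m U V \<noteq> 0\<rbrakk> \<Longrightarrow> (m, l) \<in> r"
    and CD_zero: "\<lbrakk>l \<in> \<Lambda>; S \<in> M l; T \<in> M l; U \<in> M l; V \<in> M l; T \<noteq> U\<rbrakk> \<Longrightarrow>
      C l S T * D l U V = 0"
    and CD_indep: "\<lbrakk>l \<in> \<Lambda>; S \<in> M l; T \<in> M l; U \<in> M l; V \<in> M l\<rbrakk> \<Longrightarrow>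
      C l S T * D l T V = C l S U * D l U V"
    and DC_order: "\<lbrakk>l \<in> \<Lambda>; m \<in> \<Lambda>; S \<in> M l; T \<in> M l; U \<in> M m; V \<in> M m;
      D l S T * C m U V \<noteq> 0\<rbrakk> \<Longrightarrow> (l, m) \<in> r"
    and DC_zero: "\<lbrakk>l \<in> \<Lambda>; S \<in> M l; T \<in> M l; U \<in> M l; V \<in> M l; T \<noteq> U\<rbrakk> \<Longrightarrow>
      D l S T * C l U V = 0"
    and DC_indep: "\<lbrakk>l \<in> \<Lambda>; S \<in> M l; T \<in> M l; U \<in> M l; V \<in> M l\<rbrakk> \<Longrightarrow>
      D l S T * C l T V = D l S U * C l U V"
begin

text \<open>Through this instance each result on \<open>C\<close> also holds for \<open>D\<close>
  with the reversed order, as in \<open>expand_D\<close>, \<open>CxD_order\<close> and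
  \<open>cell_form_dual_eq\<close>.\<close>

lemma dual: "dual_cell_bases scale \<Lambda> (r\<inverse>) M D C \<tau>"
proof unfold_locales
  show "partial_order_on \<Lambda> (r\<inverse>)" using order_r by simp
  show "\<tau> (D l S T * C m U V) = (if l = m \<and> S = V \<and> T = U then 1 else 0)"
    if "l \<in> \<Lambda>" "m \<in> \<Lambda>" "S \<in> M l" "T \<in> M l" "U \<in> M m" "V \<in> M m" for l m S T U V
    using that tau_dual[of m l U V S T] by (auto simp: tau_commute[of "D l S T"])
  show "D l S T * C m U V \<noteq> 0 \<Longrightarrow> (m, l) \<in> r\<inverse>"
    if "l \<in> \<Lambda>" "m \<in> \<Lambda>" "S \<in> M l" "T \<in> M l" "U \<in> M m" "V \<in> M m" for l m S T U V
    using DC_order[OF that] by simp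
  show "C l S T * D m U V \<noteq> 0 \<Longrightarrow> (l, m) \<in> r\<inverse>"
    if "l \<in> \<Lambda>" "m \<in> \<Lambda>" "S \<in> M l" "T \<in> M l" "U \<in> M m" "V \<in> M m" for l m S T U V
    using CD_order[OF that] by simp
qed (fact finite_\<Lambda> finite_M nonempty_M tau_add tau_scale tau_commute eq_0_C eq_0_D CD_zero
    CD_indep DC_zero DC_indep)+

lemma order_antisym: "(l, m) \<in> r \<Longrightarrow> (m, l) \<in> r \<Longrightarrow> l = m"
  and order_trans: "(l, m) \<in> r \<Longrightarrow> (m, n) \<in> r \<Longrightarrow> (l, n) \<in> r"
  using order_r unfolding partial_order_on_def preorder_on_def antisym_def
  by (blast, meson transE)

section \<open>Trace calculus and expansions in the dual bases\<close>

lemma tau_0 [simp]: "\<tau> 0 = 0"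
  using tau_scale[of 0 0] by simp

lemma tau_diff: "\<tau> (x - y) = \<tau> x - \<tau> y"
  using tau_add[of "x - y" y] by simp

lemma tau_sum: "\<tau> (\<Sum>p\<in>P. x p) = (\<Sum>p\<in>P. \<tau> (x p))"
  by (induction P rule: infinite_finite_induct) (simp_all add: tau_add)

abbreviation cell_index :: "('l \<times> 'm \<times> 'm) set"
  where "cell_index \<equiv> SIGMA l:\<Lambda>. M l \<times> M l"

lemma finite_cell_index: "finite cell_index"
  using finite_\<Lambda> finite_M by blast

text \<open>By duality both sides have the same trace against every \<open>D m U V\<close>, and
  \<open>eq_0_D\<close> separates elements by these traces. The indices are swapped because
  \<open>C l S T\<close> is paired with \<open>D l T S\<close>.\<close>

lemma expand_C:
  "x = (\<Sum>(l, S, T)\<in>cell_index. scale (\<tau> (x * D l T S)) (C l S T))" (is "x = ?s")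
proof -
  have "\<tau> ((x - ?s) * D m U V) = 0" if "m \<in> \<Lambda>" "U \<in> M m" "V \<in> M m" for m U V
  proof -
    have "\<tau> (?s * D m U V) = (\<Sum>p\<in>cell_index. if p = (m, V, U) then \<tau> (x * D m U V) else 0)"
      unfolding sum_distrib_right tau_sum
      by (rule sum.cong[OF refl])
        (use that in \<open>auto simp: scale_mult_left tau_scale tau_dual split: if_splits\<close>)
    also have "\<dots> = \<tau> (x * D m U V)"
      using that finite_cell_index by (simp add: sum.delta)
    finally show ?thesis by (simp add: left_diff_distrib tau_diff)
  qed
  then have "x - ?s = 0" by (rule eq_0_D)
  then show ?thesis by simp
qed

lemmas expand_D = dual_cell_bases.expand_C[OF dual]

lemma nonzero_expand_C:
  assumes "y * x * z \<noteq> 0"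
  obtains l S T where "l \<in> \<Lambda>" "S \<in> M l" "T \<in> M l" "\<tau> (x * D l T S) \<noteq> 0" "y * C l S T * z \<noteq> 0"
proof -
  have "y * x * z = (\<Sum>(l, S, T)\<in>cell_index. scale (\<tau> (x * D l T S)) (y * C l S T * z))"
    by (subst expand_C[of x])
      (simp add: sum_distrib_left sum_distrib_right case_prod_beta scale_mult_left scale_mult_right)
  with assms obtain p where "p \<in> cell_index"
    "(\<lambda>(l, S, T). scale (\<tau> (x * D l T S)) (y * C l S T * z)) p \<noteq> 0"
    by (metis (no_types, lifting) sum.neutral)
  then show ?thesis using that by auto
qed

text \<open>If \<open>C n P Q\<close> occurs in \<open>x * C m U V\<close>, then
  \<open>n \<le> m\<close>; if moreover \<open>D l S T * C n P Q\<close> is nonzero, then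
  \<open>l \<le> n\<close>.\<close>

lemma DxC_order:
  assumes "l \<in> \<Lambda>" "S \<in> M l" "T \<in> M l" "m \<in> \<Lambda>" "U \<in> M m" "V \<in> M m"
    and nz: "D l S T * x * C m U V \<noteq> 0"
  shows "(l, m) \<in> r"
proof -
  have "D l S T * (x * C m U V) * 1 \<noteq> 0" using nz by (simp add: mult.assoc)
  then obtain n P Q where n: "n \<in> \<Lambda>" "P \<in> M n" "Q \<in> M n"
    "\<tau> (x * C m U V * D n Q P) \<noteq> 0" "D l S T * C n P Q * 1 \<noteq> 0"
    by (rule nonzero_expand_C)
  have "C m U V * D n Q P \<noteq> 0" using n(4) by (auto simp: mult.assoc)
  then have "(n, m) \<in> r" using CD_order n assms by blast
  moreover have "(l, n) \<in> r" using DC_order n assms by auto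
  ultimately show ?thesis using order_trans by blast
qed

lemma CxD_order:
  assumes "l \<in> \<Lambda>" "S \<in> M l" "T \<in> M l" "m \<in> \<Lambda>" "U \<in> M m" "V \<in> M m"
    and "C l S T * x * D m U V \<noteq> 0"
  shows "(m, l) \<in> r"
  using dual_cell_bases.DxC_order[OF dual assms] by simp

section \<open>Matrix units up to a scalar\<close>

text \<open>The inner index is immaterial by \<open>CD_indep\<close>; taking \<open>T\<close> makes
  \<open>E\<close> literally the family of condition (3).\<close>

definition E :: "'l \<Rightarrow> 'm \<Rightarrow> 'm \<Rightarrow> 'a"
  where "E l S T = C l S T * D l T T"

lemma CD_eq_E: "\<lbrakk>l \<in> \<Lambda>; S \<in> M l; T \<in> M l; V \<in> M l\<rbrakk> \<Longrightarrow> C l S T * D l T V = E l S V"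
  unfolding E_def by (rule CD_indep)

lemma tau_E: "\<lbrakk>l \<in> \<Lambda>; S \<in> M l\<rbrakk> \<Longrightarrow> \<tau> (E l S S) = 1"
  unfolding E_def by (simp add: tau_dual)

text \<open>
  Expand \<open>x * D l U V\<close> in the basis \<open>D\<close>: by the order and vanishing conditions only the terms
  \<open>D l T V\<close> survive multiplication by \<open>C l S T\<close> from the left.
\<close>

lemma CxD:
  assumes l: "l \<in> \<Lambda>" and M: "S \<in> M l" "T \<in> M l" "U \<in> M l" "V \<in> M l"
  shows "C l S T * x * D l U V = scale (\<tau> (C l V T * x * D l U V)) (E l S V)"
proof -
  let ?y = "x * D l U V"
  have "C l S T * ?y = (\<Sum>(n, P, Q)\<in>cell_index. scale (\<tau> (?y * C n Q P)) (C l S T * D n P Q))"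
    by (subst expand_D[of ?y]) (simp add: sum_distrib_left case_prod_beta scale_mult_right)
  also have "\<dots> = (\<Sum>p\<in>cell_index. if p = (l, T, V) then scale (\<tau> (?y * C l V T)) (E l S V) else 0)"
  proof (rule sum.cong[OF refl], clarify)
    fix n P Q assume n: "n \<in> \<Lambda>" "P \<in> M n" "Q \<in> M n"
    show "scale (\<tau> (?y * C n Q P)) (C l S T * D n P Q) =
        (if (n, P, Q) = (l, T, V) then scale (\<tau> (?y * C l V T)) (E l S V) else 0)"
    proof (cases "(n, P, Q) = (l, T, V)")
      case True
      then show ?thesis using l M by (simp add: CD_eq_E)
    next
      case False
      \<comment> \<open>The first alternative kills the coefficient, the second the product. For
        \<open>n = l\<close> they cover \<open>Q \<noteq> V\<close> and \<open>P \<noteq> T\<close>;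
        for \<open>n \<noteq> l\<close>, the failure of both would give \<open>l \<le> n\<close> and
        \<open>n \<le> l\<close>.\<close>
      have "D l U V * C n Q P = 0 \<or> C l S T * D n P Q = 0"
      proof (cases "n = l")
        case True
        then show ?thesis using False CD_zero DC_zero l M n by auto
      next
        case False
        then show ?thesis using CD_order DC_order order_antisym l M n by metis
      qed
      then show ?thesis using False by (auto simp: mult.assoc)
    qed
  qed
  also have "\<dots> = scale (\<tau> (?y * C l V T)) (E l S V)"
    using l M finite_cell_index by (simp add: sum.delta)
  also have "\<tau> (?y * C l V T) = \<tau> (C l V T * x * D l U V)"
    unfolding mult.assoc[of "C l V T"] by (rule tau_commute)
  finally show ?thesis by (simp add: mult.assoc)
qed

text \<open>The factor by which \<open>E l T T * E l T T\<close> is a multiple of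
  \<open>E l T T\<close>, read off by \<open>\<tau>\<close> since
  \<open>\<tau> (E l T T) = 1\<close>. The choice of \<open>T\<close> is immaterial by
  \<open>kappa_eq\<close>.\<close>

definition kappa :: "'l \<Rightarrow> 'k"
  where "kappa l = (let T = SOME T. T \<in> M l in \<tau> (E l T T * E l T T))"

text \<open>\<open>CD_indep\<close> makes \<open>T\<close> and \<open>U\<close> replaceable; after a
  cyclic rotation under the trace, \<open>DC_indep\<close> does the same for \<open>V\<close> and
  \<open>W\<close>.\<close>

lemma kappa_eq:
  assumes l: "l \<in> \<Lambda>" and M: "T \<in> M l" "U \<in> M l" "V \<in> M l" "W \<in> M l"
  shows "\<tau> (C l W T * D l T V * C l V U * D l U W) = kappa l"
proof -
  define X where "X = (SOME T. T \<in> M l)"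
  have X: "X \<in> M l" using nonempty_M[OF l] unfolding X_def by (simp add: some_in_eq)
  have "\<tau> (C l W T * D l T V * C l V U * D l U W) =
      \<tau> ((C l W T * D l T V) * (C l V U * D l U W))"
    by (simp add: mult.assoc)
  also have "\<dots> = \<tau> ((C l W X * D l X V) * (C l V X * D l X W))"
    using CD_indep l M X by metis
  also have "\<dots> = \<tau> (C l W X * ((D l X V * C l V X) * D l X W))"
    by (simp add: mult.assoc)
  also have "\<dots> = \<tau> (((D l X V * C l V X) * D l X W) * C l W X)"
    by (rule tau_commute)
  also have "\<dots> = \<tau> ((D l X V * C l V X) * (D l X W * C l W X))"
    by (simp add: mult.assoc)
  also have "\<dots> = \<tau> ((D l X X * C l X X) * (D l X X * C l X X))"
    using DC_indep l M X by metis
  also have "\<dots> = \<tau> (D l X X * (C l X X * D l X X * C l X X))"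
    by (simp add: mult.assoc)
  also have "\<dots> = \<tau> ((C l X X * D l X X * C l X X) * D l X X)"
    by (rule tau_commute)
  also have "\<dots> = \<tau> (E l X X * E l X X)"
    by (simp add: E_def mult.assoc)
  finally show ?thesis unfolding kappa_def X_def by (simp add: Let_def)
qed

text \<open>By \<open>CxD\<close> the middle factor \<open>D l V V * C l U W\<close> contributes
  only a trace, which is \<open>0\<close> by \<open>DC_zero\<close> or \<open>kappa l\<close> by
  \<open>kappa_eq\<close>.\<close>

lemma E_mult_E:
  assumes l: "l \<in> \<Lambda>" and M: "S \<in> M l" "V \<in> M l" "U \<in> M l" "W \<in> M l"
  shows "E l S V * E l U W = (if U = V then scale (kappa l) (E l S W) else 0)"
proof -
  have "E l S V * E l U W = C l S V * (D l V V * C l U W) * D l W W"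
    by (simp add: E_def mult.assoc)
  also have "\<dots> = scale (\<tau> (C l W V * (D l V V * C l U W) * D l W W)) (E l S W)"
    using l M by (intro CxD)
  also have "\<tau> (C l W V * (D l V V * C l U W) * D l W W) = (if U = V then kappa l else 0)"
    using DC_zero[OF l M(2) M(2) M(3) M(4)] kappa_eq[OF l M(2) M(4) M(2) M(4)]
    by (cases "U = V") (simp_all add: mult.assoc)
  finally show ?thesis by simp
qed

lemma ExE:
  assumes "l \<in> \<Lambda>" "S \<in> M l" "V \<in> M l" "U \<in> M l" "W \<in> M l"
  shows "\<exists>c. E l S V * x * E l U W = scale c (E l S W)"
proof
  show "E l S V * x * E l U W = scale (\<tau> (C l W V * (D l V V * x * C l U W) * D l W W)) (E l S W)"
    using CxD[of l S V W W "D l V V * x * C l U W"] assms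
    by (simp add: E_def[of l S V] E_def[of l U W] mult.assoc)
qed

text \<open>In a nonzero product the inner factor \<open>D l V V * C m U W\<close> forces
  \<open>l \<le> m\<close>, while the outer factors \<open>C l S V\<close> and
  \<open>D m W W\<close> force \<open>m \<le> l\<close>.\<close>

lemma E_mult_E_neq:
  assumes "l \<in> \<Lambda>" "m \<in> \<Lambda>" "l \<noteq> m" "S \<in> M l" "V \<in> M l" "U \<in> M m" "W \<in> M m"
  shows "E l S V * E m U W = 0"
proof (rule ccontr)
  assume nz: "E l S V * E m U W \<noteq> 0"
  then have "D l V V * C m U W \<noteq> 0"
    by (metis E_def mult.assoc mult_zero_left mult_zero_right)
  moreover have "C l S V * (D l V V * C m U W) * D m W W \<noteq> 0"
    using nz by (simp add: E_def mult.assoc)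
  ultimately show False
    using DC_order CxD_order order_antisym assms by metis
qed

text \<open>The square is \<open>kappa l\<close> times \<open>E l S S\<close>, and
  \<open>E l S S\<close> has trace \<open>1\<close>. As \<open>kappa l\<close> involves neither
  \<open>S\<close> nor \<open>T\<close>, conditions (4) and (5) coincide.\<close>

lemma E_square_nonzero_iff:
  assumes "l \<in> \<Lambda>" "S \<in> M l" "T \<in> M l"
  shows "(C l S T * D l T S)\<^sup>2 \<noteq> 0 \<longleftrightarrow> kappa l \<noteq> 0"
proof -
  have "(C l S T * D l T S)\<^sup>2 = scale (kappa l) (E l S S)"
    using assms by (simp add: CD_eq_E power2_eq_square E_mult_E)
  moreover have "E l S S \<noteq> 0"
    using tau_E[of l S] assms by auto
  ultimately show ?thesis by simp
qed

section \<open>The basis condition, semisimplicity and the scalars \<open>kappa l\<close>\<close>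

text \<open>Multiplying a linear relation by \<open>E l S S\<close> on the left and by
  \<open>E l T S\<close> on the right leaves only the coefficient of \<open>E l S T\<close>, times
  the square of \<open>kappa l\<close>.\<close>

lemma basis_E:
  assumes C: "cell_basis scale \<Lambda> M C" and k: "\<And>l. l \<in> \<Lambda> \<Longrightarrow> kappa l \<noteq> 0"
  shows "cell_basis scale \<Lambda> M E"
  unfolding cell_basis_def
proof (rule basis_familyI[OF finite_cell_index C[unfolded cell_basis_def]])
  fix u p
  assume 0: "(\<Sum>q\<in>cell_index. scale (u q) (case q of (l, S, T) \<Rightarrow> E l S T)) = 0" and p: "p \<in> cell_index"
  obtain l S T where p': "p = (l, S, T)" "l \<in> \<Lambda>" "S \<in> M l" "T \<in> M l" using p by auto
  have "0 = E l S S * (\<Sum>q\<in>cell_index. scale (u q) (case q of (l, S, T) \<Rightarrow> E l S T)) * E l T S"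
    using 0 by simp
  also have "\<dots> = (\<Sum>q\<in>cell_index. if q = p then scale (u p * kappa l * kappa l) (E l S S) else 0)"
    unfolding sum_distrib_left sum_distrib_right
  proof (rule sum.cong[OF refl], clarify)
    fix m U V assume q: "m \<in> \<Lambda>" "U \<in> M m" "V \<in> M m"
    show "E l S S * scale (u (m, U, V)) (E m U V) * E l T S =
        (if (m, U, V) = p then scale (u p * kappa l * kappa l) (E l S S) else 0)"
      using q p' by (cases "m = l")
        (auto simp: scale_mult_left scale_mult_right E_mult_E E_mult_E_neq mult.assoc)
  qed
  also have "\<dots> = scale (u p * kappa l * kappa l) (E l S S)"
    using p finite_cell_index by (simp add: sum.delta)
  finally have "u p * kappa l * kappa l = 0"
    using p' tau_E[of l S] by auto
  then show "u p = 0" using k p' by simp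
qed

text \<open>Expanding \<open>1\<close> in the basis \<open>E\<close> shows
  \<open>x = x * 1 = 0\<close>.\<close>

lemma mult_eq_0_if_basis_E:
  assumes E: "cell_basis scale \<Lambda> M E"
    and 0: "\<And>l S T. l \<in> \<Lambda> \<Longrightarrow> S \<in> M l \<Longrightarrow> T \<in> M l \<Longrightarrow> x * E l S T = 0"
  shows "x = 0"
proof -
  have "1 \<in> span ((\<lambda>(l, S, T). E l S T) ` cell_index)"
    using E unfolding cell_basis_def basis_family_def by simp
  then have "x * 1 = 0"
    by (induction rule: span_induct_alt) (auto simp: distrib_left scale_mult_right 0)
  then show ?thesis by simp
qed

lemma kappa_nonzero_if_basis_E:
  assumes E: "cell_basis scale \<Lambda> M E" and l: "l \<in> \<Lambda>"
  shows "kappa l \<noteq> 0"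
proof
  assume k: "kappa l = 0"
  obtain S where S: "S \<in> M l" using nonempty_M[OF l] by blast
  have "E l S S = 0"
  proof (rule mult_eq_0_if_basis_E[OF E])
    show "E l S S * E m U V = 0" if "m \<in> \<Lambda>" "U \<in> M m" "V \<in> M m" for m U V
      using that l S k by (cases "m = l") (auto simp: E_mult_E E_mult_E_neq)
  qed
  then show False using tau_E[OF l S] by simp
qed

text \<open>For \<open>e = E l S S\<close>, the element \<open>e * x * e\<close> is a multiple of
  \<open>e\<close> with factor \<open>\<tau> (e * x * e) = \<tau> (e * e * x)\<close>, and
  \<open>e * e = 0\<close> if \<open>kappa l = 0\<close>.\<close>

lemma kappa_nonzero_if_semisimple:
  assumes ss: "semisimple_algebra TYPE('a)" and l: "l \<in> \<Lambda>"
  shows "kappa l \<noteq> 0"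
proof
  assume k: "kappa l = 0"
  obtain S where S: "S \<in> M l" using nonempty_M[OF l] by blast
  have "E l S S * x * E l S S = 0" for x
  proof -
    obtain c where c: "E l S S * x * E l S S = scale c (E l S S)"
      using ExE[OF l S S S S] by blast
    have "c = \<tau> ((E l S S * x) * E l S S)" using c tau_E[OF l S] by (simp add: tau_scale)
    also have "\<dots> = \<tau> (E l S S * E l S S * x)"
      by (subst tau_commute) (simp add: mult.assoc)
    also have "\<dots> = 0" using k l S by (simp add: E_mult_E)
    finally show ?thesis using c by simp
  qed
  from semisimple_algebra_semiprime[OF ss this] show False
    using tau_E[OF l S] by simp
qed

text \<open>The elements \<open>E l T T / kappa l\<close> are orthogonal primitive idempotents with sum \<open>1\<close>.\<close>

lemma semisimple_if_kappa_nonzero: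
  assumes E: "cell_basis scale \<Lambda> M E" and k: "\<And>l. l \<in> \<Lambda> \<Longrightarrow> kappa l \<noteq> 0"
  shows "semisimple_algebra TYPE('a)"
proof (rule semisimple_algebra_idempotents)
  let ?J = "SIGMA l:\<Lambda>. M l"
  let ?e = "\<lambda>(l, T). scale (inverse (kappa l)) (E l T T)"
  show J: "finite ?J" using finite_\<Lambda> finite_M by blast
  show "?e p * ?e q = (if p = q then ?e p else 0)" if "p \<in> ?J" "q \<in> ?J" for p q
    using that k
    by (cases p; cases q; cases "fst p = fst q")
      (auto simp: scale_mult_left scale_mult_right E_mult_E E_mult_E_neq)
  show one: "(\<Sum>p\<in>?J. ?e p) = 1"
  proof -
    \<comment> \<open>On \<open>E m U V\<close> only the summand with index \<open>(m, U)\<close>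
      acts, and it acts as the identity.\<close>
    have "((\<Sum>p\<in>?J. ?e p) - 1) * E m U V = 0" if "m \<in> \<Lambda>" "U \<in> M m" "V \<in> M m" for m U V
    proof -
      have "(\<Sum>p\<in>?J. ?e p) * E m U V = (\<Sum>p\<in>?J. if p = (m, U) then E m U V else 0)"
        unfolding sum_distrib_right
      proof (rule sum.cong[OF refl], clarify)
        fix l T assume "l \<in> \<Lambda>" "T \<in> M l"
        then show "scale (inverse (kappa l)) (E l T T) * E m U V =
            (if (l, T) = (m, U) then E m U V else 0)"
          using that k by (cases "l = m") (auto simp: scale_mult_left E_mult_E E_mult_E_neq)
      qed
      also have "\<dots> = E m U V" using that J by (simp add: sum.delta)
      finally show ?thesis by (simp add: left_diff_distrib)
    qed
    then have "(\<Sum>p\<in>?J. ?e p) - 1 = 0" by (rule mult_eq_0_if_basis_E[OF E])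
    then show ?thesis by simp
  qed
  fix p assume "p \<in> ?J"
  then obtain l T where p: "p = (l, T)" "l \<in> \<Lambda>" "T \<in> M l" by auto
  have ee: "E l T T * ?e p = E l T T"
    using p k by (simp add: scale_mult_right E_mult_E)
  show "minimal_left_ideal (range (\<lambda>a. a * ?e p))"
    unfolding minimal_left_ideal_def
  proof (intro conjI allI impI)
    show "left_ideal (range (\<lambda>a. a * ?e p))"
      by (rule left_ideal_range_mult)
    have "E l T T \<in> range (\<lambda>a. a * ?e p)" 
      by (rule range_eqI[of _ _ "E l T T"]) (simp only: ee)
    then show "range (\<lambda>a. a * ?e p) \<noteq> {0}" 
      using tau_0 tau_E[OF p(2,3)] by (metis singletonD zero_neq_one)
    fix L' assume L': "left_ideal L' \<and> L' \<subseteq> range (\<lambda>a. a * ?e p)"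
    then have mult_L': "a * y \<in> L'" if "y \<in> L'" for a y
      using that unfolding left_ideal_def by blast
    show "L' = {0} \<or> L' = range (\<lambda>a. a * ?e p)"
    proof (cases "L' \<subseteq> {0}")
      case True
      then show ?thesis using L' unfolding left_ideal_def by blast
    next
      case False
      then obtain y where y: "y \<in> L'" "y \<noteq> 0" by blast
      then obtain a where a: "y = a * ?e p" using L' by blast
      \<comment> \<open>Since the idempotents sum to \<open>1\<close>, one of them does not
        annihilate \<open>y\<close>. Left multiplications will then carry \<open>y\<close> to the
        generator \<open>?e p\<close>, so \<open>L'\<close> is the whole ideal.\<close>
      have "(\<Sum>q\<in>?J. ?e q * y) \<noteq> 0"
        using y one by (simp flip: sum_distrib_right)
      then obtain q where q: "q \<in> ?J" "?e q * y \<noteq> 0" by (metis (mono_tags, lifting) sum.neutral)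
      then obtain m S where mS: "q = (m, S)" "m \<in> \<Lambda>" "S \<in> M m" by auto
      have nz: "E m S S * y \<noteq> 0" using q mS by (auto simp: scale_mult_left)
      \<comment> \<open>The factor \<open>D m S S * a * C l T T\<close> gives
        \<open>m \<le> l\<close>, and the enclosing \<open>C m S S\<close> and
        \<open>D l T T\<close> give \<open>l \<le> m\<close>.\<close>
      have "m = l"
      proof (rule ccontr)
        assume "m \<noteq> l"
        have "E m S S * a * E l T T \<noteq> 0"
          using nz a p by (auto simp: scale_mult_right mult.assoc)
        then have "C m S S * (D m S S * a * C l T T) * D l T T \<noteq> 0"
          by (simp add: E_def mult.assoc)
        moreover have "D m S S * a * C l T T \<noteq> 0"
          using calculation by auto
        ultimately have "(l, m) \<in> r" "(m, l) \<in> r"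
          using CxD_order DxC_order mS p by blast+
        then show False using \<open>m \<noteq> l\<close> order_antisym by blast
      qed
      obtain c where c: "E l S S * a * E l T T = scale c (E l S T)"
        using ExE mS p \<open>m = l\<close> by blast
      have Sy: "E l S S * y = scale (c * inverse (kappa l)) (E l S T)"
        using c a p by (simp add: scale_mult_right mult.assoc[symmetric] mult.commute)
      then have "c \<noteq> 0" using nz \<open>m = l\<close> by auto
      have "E l T S * (E l S S * y) = scale c (E l T T)"
        unfolding Sy using mS p k \<open>m = l\<close> by (simp add: scale_mult_right E_mult_E)
      then have "scale c (E l T T) \<in> L'" using mult_L' y by metis
      \<comment> \<open>A left ideal is closed under ring multiplication only, so the scalar is
        applied as a multiple of \<open>1\<close>.\<close>
      then have "scale (inverse (kappa l) * inverse c) 1 * scale c (E l T T) \<in> L'"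
        by (rule mult_L')
      then have "?e p \<in> L'" using \<open>c \<noteq> 0\<close> p by (simp add: scale_mult_left mult.assoc)
      then have "range (\<lambda>a. a * ?e p) \<subseteq> L'" using mult_L' by blast
      then show ?thesis using L' by blast
    qed
  qed
qed

section \<open>Cell forms and the constants of the second condition\<close>

text \<open>The trace \<open>\<tau> (x * D m V U)\<close> is the coefficient of
  \<open>C m U V\<close> in \<open>x\<close>, so congruences modulo \<open>A(<l)\<close> become
  conditions on traces.\<close>

lemma cell_below_iff:
  "x \<in> cell_below scale \<Lambda> r M C l \<longleftrightarrow>
    (\<forall>m\<in>\<Lambda>. \<forall>U\<in>M m. \<forall>V\<in>M m. \<tau> (x * D m V U) \<noteq> 0 \<longrightarrow> (m, l) \<in> r \<and> m \<noteq> l)"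
  (is "_ \<longleftrightarrow> ?R")
proof
  assume "x \<in> cell_below scale \<Lambda> r M C l"
  then show ?R
    unfolding cell_below_def
  proof (induction rule: span_induct_alt)
    case base
    then show ?case by simp
  next
    case (step c y z)
    then show ?case
      by (auto simp: distrib_right tau_add scale_mult_left tau_scale tau_dual split: if_splits)
  qed
next
  assume R: ?R
  have "(\<Sum>(m, U, V)\<in>cell_index. scale (\<tau> (x * D m V U)) (C m U V)) \<in> cell_below scale \<Lambda> r M C l"
    unfolding cell_below_def
  proof (rule span_sum, clarify)
    fix m U V assume m: "m \<in> \<Lambda>" "U \<in> M m" "V \<in> M m"
    show "scale (\<tau> (x * D m V U)) (C m U V)
        \<in> span {C m S T |m S T. m \<in> \<Lambda> \<and> (m, l) \<in> r \<and> m \<noteq> l \<and> S \<in> M m \<and> T \<in> M m}"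
    proof (cases "\<tau> (x * D m V U) = 0")
      case True
      then show ?thesis by (simp add: span_zero)
    next
      case False
      with R m have "(m, l) \<in> r \<and> m \<noteq> l" by blast
      with m show ?thesis by (intro span_scale span_base) blast
    qed
  qed
  then show "x \<in> cell_below scale \<Lambda> r M C l" using expand_C[of x] by simp
qed

text \<open>Apart from \<open>C l S V\<close>, only basis elements with index strictly below
  \<open>l\<close> occur in \<open>C l S T * C l U V\<close>; hence \<open>c\<close> has to be the
  coefficient of \<open>C l S V\<close>.\<close>

lemma C_mult_C:
  assumes l: "l \<in> \<Lambda>" and M: "S \<in> M l" "T \<in> M l" "U \<in> M l" "V \<in> M l"
  shows "C l S T * C l U V - scale c (C l S V) \<in> cell_below scale \<Lambda> r M C l \<longleftrightarrow>
    c = \<tau> (C l S T * C l U V * D l V S)"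
proof -
  let ?x = "C l S T * C l U V - scale c (C l S V)"
  have *: "\<tau> (?x * D m Y X) = \<tau> (C l S T * C l U V * D m Y X) -
      (if m = l \<and> X = S \<and> Y = V then c else 0)" if "m \<in> \<Lambda>" "X \<in> M m" "Y \<in> M m" for m X Y
    using l M that by (auto simp: left_diff_distrib tau_diff scale_mult_left tau_scale tau_dual)
  have **: "(m, l) \<in> r \<and> (m \<noteq> l \<or> X = S \<and> Y = V)"
    if "m \<in> \<Lambda>" "X \<in> M m" "Y \<in> M m" "\<tau> (C l S T * C l U V * D m Y X) \<noteq> 0" for m X Y
  proof -
    have 1: "C l U V * D m Y X \<noteq> 0" using that(4) by (auto simp: mult.assoc)
    \<comment> \<open>Rotation puts \<open>D m Y X\<close> before \<open>C l S T\<close>, so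
      \<open>DC_zero\<close> yields \<open>X = S\<close> when \<open>m = l\<close>, just as
      \<open>1\<close> yields \<open>Y = V\<close>.\<close>
    have "\<tau> (D m Y X * C l S T * C l U V) \<noteq> 0"
      using that(4) by (metis mult.assoc tau_commute)
    then have 2: "D m Y X * C l S T \<noteq> 0" by auto
    show ?thesis using 1 2 CD_order CD_zero DC_zero l M that by metis
  qed
  show ?thesis
    unfolding cell_below_iff
  proof
    assume "\<forall>m\<in>\<Lambda>. \<forall>X\<in>M m. \<forall>Y\<in>M m. \<tau> (?x * D m Y X) \<noteq> 0 \<longrightarrow> (m, l) \<in> r \<and> m \<noteq> l"
    then have "\<tau> (?x * D l V S) = 0" using l M by blast
    then show "c = \<tau> (C l S T * C l U V * D l V S)" using * l M by simp
  next
    assume "c = \<tau> (C l S T * C l U V * D l V S)"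
    then show "\<forall>m\<in>\<Lambda>. \<forall>X\<in>M m. \<forall>Y\<in>M m. \<tau> (?x * D m Y X) \<noteq> 0 \<longrightarrow> (m, l) \<in> r \<and> m \<noteq> l"
      using * ** by (auto split: if_splits)
  qed
qed

text \<open>The coefficient found in \<open>C_mult_C\<close> is independent of \<open>V\<close> by
  \<open>CD_indep\<close> and, after rotation, of \<open>S\<close> by \<open>DC_indep\<close>. So
  the definite description has exactly one solution.\<close>

lemma cell_form_eq:
  assumes l: "l \<in> \<Lambda>" and M: "S \<in> M l" "T \<in> M l" "U \<in> M l" "V \<in> M l"
  shows "cell_form scale \<Lambda> r M C l T U = \<tau> (C l S T * C l U V * D l V S)"
proof -
  have eq: "\<tau> (C l P T * C l U Q * D l Q P) = \<tau> (C l S T * C l U V * D l V S)"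
    if "P \<in> M l" "Q \<in> M l" for P Q
  proof -
    have "\<tau> (C l P T * C l U Q * D l Q P) = \<tau> (C l P T * (C l U Q * D l Q P))"
      by (simp add: mult.assoc)
    also have "\<dots> = \<tau> (C l P T * (C l U V * D l V P))"
      using CD_indep l M that by metis
    also have "\<dots> = \<tau> (C l U V * (D l V P * C l P T))"
      by (subst tau_commute) (simp add: mult.assoc)
    also have "\<dots> = \<tau> (C l U V * (D l V S * C l S T))"
      using DC_indep l M that by metis
    also have "\<dots> = \<tau> (C l S T * C l U V * D l V S)"
      by (subst mult.assoc[symmetric], subst tau_commute) (simp add: mult.assoc)
    finally show ?thesis .
  qed
  show ?thesis
    unfolding cell_form_def
  proof (rule the_equality)
    show "\<forall>P\<in>M l. \<forall>Q\<in>M l. C l P T * C l U Q - scale (\<tau> (C l S T * C l U V * D l V S)) (C l P Q)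
        \<in> cell_below scale \<Lambda> r M C l"
      using l M by (intro ballI C_mult_C[THEN iffD2] eq[symmetric])
    show "c = \<tau> (C l S T * C l U V * D l V S)"
      if "\<forall>P\<in>M l. \<forall>Q\<in>M l. C l P T * C l U Q - scale c (C l P Q) \<in> cell_below scale \<Lambda> r M C l" for c
      using that l M by (intro C_mult_C[THEN iffD1]) blast+
  qed
qed

lemmas cell_form_dual_eq = dual_cell_bases.cell_form_eq[OF dual]

lemma kappa_eq_sum_cell_form:
  assumes l: "l \<in> \<Lambda>" and T: "T \<in> M l"
  shows "kappa l = (\<Sum>P\<in>M l. cell_form scale \<Lambda> r M C l T P * cell_form scale \<Lambda> (r\<inverse>) M D l P T)"
proof -
  let ?y = "D l T T * C l T T"
  have "kappa l = \<tau> (C l T T * (D l T T * C l T T * D l T T))"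
    using kappa_eq[OF l T T T T] by (simp add: mult.assoc)
  also have "\<dots> = \<tau> (?y * ?y)"
    by (subst tau_commute) (simp add: mult.assoc)
  also have "\<dots> = (\<Sum>(n, P, Q)\<in>cell_index. \<tau> (?y * D n Q P) * \<tau> (?y * C n P Q))"
    by (subst (2) expand_C[of ?y])
      (simp add: sum_distrib_left tau_sum case_prod_beta scale_mult_right tau_scale)
  \<comment> \<open>In a nonzero term the first trace gives \<open>n \<le> l\<close> and the second
    \<open>l \<le> n\<close>; then \<open>CD_zero\<close> gives \<open>Q = T\<close>.\<close>
  also have "\<dots> = (\<Sum>(n, P, Q)\<in>(\<lambda>P. (l, P, T)) ` M l. \<tau> (?y * D n Q P) * \<tau> (?y * C n P Q))"
  proof (rule sum.mono_neutral_right[OF finite_cell_index])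
    show "(\<lambda>P. (l, P, T)) ` M l \<subseteq> cell_index" using l T by auto
    show "\<forall>p\<in>cell_index - (\<lambda>P. (l, P, T)) ` M l.
        (case p of (n, P, Q) \<Rightarrow> \<tau> (?y * D n Q P) * \<tau> (?y * C n P Q)) = 0"
    proof clarify
      fix n P Q assume n: "n \<in> \<Lambda>" "P \<in> M n" "Q \<in> M n" and nin: "(n, P, Q) \<notin> (\<lambda>P. (l, P, T)) ` M l"
      show "\<tau> (?y * D n Q P) * \<tau> (?y * C n P Q) = 0"
      proof (rule ccontr)
        assume "\<tau> (?y * D n Q P) * \<tau> (?y * C n P Q) \<noteq> 0"
        then have nz: "\<tau> (?y * D n Q P) \<noteq> 0" "\<tau> (?y * C n P Q) \<noteq> 0" by auto
        have 1: "C l T T * D n Q P \<noteq> 0" using nz(1) by (auto simp: mult.assoc)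
        have "\<tau> (C n P Q * D l T T * C l T T) \<noteq> 0"
          using nz(2) by (metis mult.assoc tau_commute)
        then have "C n P Q * D l T T \<noteq> 0" by auto
        then have "(l, n) \<in> r" using CD_order l n T by blast
        moreover have "(n, l) \<in> r" using 1 CD_order l n T by blast
        ultimately have "n = l" using order_antisym by blast
        then show False using 1 CD_zero[of l T T Q P] n l T nin by auto
      qed
    qed
  qed
  also have "\<dots> = (\<Sum>P\<in>M l. \<tau> (?y * D l T P) * \<tau> (?y * C l P T))"
    by (subst sum.reindex) (auto simp: inj_on_def)
  also have "\<dots> = (\<Sum>P\<in>M l. cell_form scale \<Lambda> r M C l T P * cell_form scale \<Lambda> (r\<inverse>) M D l P T)"
  proof (rule sum.cong[OF refl])
    fix P assume P: "P \<in> M l"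
    have "\<tau> (?y * C l P T) = \<tau> (C l T T * C l P T * D l T T)"
      by (subst (2) tau_commute) (simp add: mult.assoc)
    moreover have "\<tau> (?y * D l T P) = \<tau> (D l T P * D l T T * C l T T)"
      by (subst tau_commute) (simp add: mult.assoc)
    ultimately show "\<tau> (?y * D l T P) * \<tau> (?y * C l P T) =
        cell_form scale \<Lambda> r M C l T P * cell_form scale \<Lambda> (r\<inverse>) M D l P T"
      using cell_form_eq[OF l T T P T] cell_form_dual_eq[OF l T P T T] by simp
  qed
  finally show ?thesis .
qed

text \<open>The sum for \<open>kappa l\<close> has the arguments of the first form in the opposite
  order; \<open>sym\<close> repairs this and is supplied later by the anti-automorphism.\<close>

lemma cell_const_eq_kappa:
  assumes l: "l \<in> \<Lambda>"
    and sym: "\<And>T U. T \<in> M l \<Longrightarrow> U \<in> M l \<Longrightarrow>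
      cell_form scale \<Lambda> r M C l T U = cell_form scale \<Lambda> r M C l U T"
  shows "cell_const scale \<Lambda> r M C D l = kappa l"
proof -
  have "kappa l = (\<Sum>X\<in>M l. cell_form scale \<Lambda> r M C l X V * cell_form scale \<Lambda> (r\<inverse>) M D l X V)"
    if "V \<in> M l" for V
    unfolding kappa_eq_sum_cell_form[OF l that]
    by (rule sum.cong[OF refl]) (simp add: sym that)
  then show ?thesis
    unfolding cell_const_def using nonempty_M[OF l] by (intro the_equality) auto
qed

end

section \<open>Symmetric cellular algebras\<close>

context cellular_algebra
begin

section \<open>The two-sided ideals \<open>A(<l)\<close>\<close>

abbreviation below :: "'l \<Rightarrow> 'a set"
  where "below \<equiv> cell_below scale \<Lambda> r M C"

lemma subspace_below: "subspace (below l)"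
  unfolding cell_below_def by (rule subspace_span)

lemmas below_add = subspace_add[OF subspace_below]
  and below_diff = subspace_diff[OF subspace_below]
  and below_scale = subspace_scale[OF subspace_below]

lemma C_in_below:
  "\<lbrakk>m \<in> \<Lambda>; (m, l) \<in> r; m \<noteq> l; S \<in> M m; T \<in> M m\<rbrakk> \<Longrightarrow> C m S T \<in> below l"
  unfolding cell_below_def by (intro span_base) blast

lemma below_induct [consumes 1, case_names zero step]:
  assumes "x \<in> below l" and "P 0"
    and "\<And>c m S T y. \<lbrakk>m \<in> \<Lambda>; (m, l) \<in> r; m \<noteq> l; S \<in> M m; T \<in> M m; P y\<rbrakk> \<Longrightarrow> P (scale c (C m S T) + y)"
  shows "P x"
  using assms(1) unfolding cell_below_def
  by (induction rule: span_induct_alt) (use assms(2,3) in auto)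

lemma below_mono:
  assumes ml: "(m, l) \<in> r" "m \<noteq> l"
  shows "below m \<subseteq> below l"
proof -
  have "(n, l) \<in> r \<and> n \<noteq> l" if "(n, m) \<in> r" "n \<noteq> m" for n
    using that ml finite_poset(2)
    unfolding partial_order_on_def preorder_on_def antisym_def by (meson transE)
  then show ?thesis
    unfolding cell_below_def by (intro span_mono) blast
qed

text \<open>By (C3), \<open>a * C m S T\<close> is a combination of elements \<open>C m S' T\<close>
  plus an element of \<open>below m\<close>, and both lie in \<open>below l\<close> when
  \<open>m < l\<close>.\<close>

lemma mult_left_below: "x \<in> below l \<Longrightarrow> a * x \<in> below l"
proof (induction rule: below_induct)
  case zero
  then show ?case by (simp add: subspace_0[OF subspace_below])
next
  case (step c m S T y)
  obtain \<rho> where \<rho>: "\<forall>S\<in>M m. \<forall>T\<in>M m.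
      a * C m S T - (\<Sum>S'\<in>M m. scale (\<rho> S' S) (C m S' T)) \<in> below m"
    using mult_C step.hyps(1) by blast
  have "(\<Sum>S'\<in>M m. scale (\<rho> S' S) (C m S' T)) \<in> below l"
    using step.hyps by (intro subspace_sum[OF subspace_below] below_scale C_in_below)
  moreover have "a * C m S T - (\<Sum>S'\<in>M m. scale (\<rho> S' S) (C m S' T)) \<in> below l"
    using \<rho> step.hyps below_mono by blast
  ultimately have "a * C m S T \<in> below l"
    using below_add by fastforce
  then show ?case
    using step.IH by (simp add: distrib_left scale_mult_right below_add below_scale)
qed

lemma i_add: "i (x + y) = i x + i y"
  and i_diff: "i (x - y) = i x - i y"
  and i_scale: "i (scale c x) = scale c (i x)"
  and i_sum: "i (\<Sum>p\<in>P. g p) = (\<Sum>p\<in>P. i (g p))"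
  and i_0: "i 0 = 0"
proof -
  interpret Vector_Spaces.linear scale scale i by (rule linear_i)
  show "i (x + y) = i x + i y" "i (x - y) = i x - i y" "i (scale c x) = scale c (i x)"
    "i (\<Sum>p\<in>P. g p) = (\<Sum>p\<in>P. i (g p))" "i 0 = 0"
    by (rule add diff scale sum zero)+
qed

lemma i_below: "x \<in> below l \<Longrightarrow> i x \<in> below l"
proof (induction rule: below_induct)
  case zero
  then show ?case by (simp add: i_0 subspace_0[OF subspace_below])
next
  case (step c m S T y)
  have "i (C m S T) - C m T S \<in> below l"
    using i_C step.hyps below_mono by blast
  moreover have "C m T S \<in> below l"
    using step.hyps by (intro C_in_below)
  ultimately have "i (C m S T) \<in> below l"
    using below_add by fastforce
  then show ?case
    using step.IH by (simp add: i_add i_scale below_add below_scale)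
qed

text \<open>The involution turns right into left multiplication:
  \<open>x * a = i (i a * i x)\<close>.\<close>

lemma mult_right_below:
  assumes "x \<in> below l" shows "x * a \<in> below l"
proof -
  have "i (i a * i x) \<in> below l"
    using assms by (intro i_below mult_left_below)
  then show ?thesis by (simp add: anti_mult_i involution_i)
qed

text \<open>The image under \<open>i\<close> of (C3) for \<open>i a\<close>. Since \<open>i\<close>
  swaps the indices only modulo \<open>below l\<close>, the facts \<open>2\<close> and
  \<open>3\<close> correct \<open>i (C l T' S)\<close> to \<open>C l S T'\<close> and
  \<open>i (C l T S)\<close> to \<open>C l S T\<close>.\<close>

lemma mult_C_right:
  assumes l: "l \<in> \<Lambda>"
  shows "\<exists>\<rho>. \<forall>S\<in>M l. \<forall>T\<in>M l.
    C l S T * a - (\<Sum>T'\<in>M l. scale (\<rho> T' T) (C l S T')) \<in> below l"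
proof -
  obtain \<rho> where \<rho>: "\<forall>S\<in>M l. \<forall>T\<in>M l.
      i a * C l S T - (\<Sum>S'\<in>M l. scale (\<rho> S' S) (C l S' T)) \<in> below l"
    using mult_C[OF l] by blast
  have "C l S T * a - (\<Sum>T'\<in>M l. scale (\<rho> T' T) (C l S T')) \<in> below l"
    if S: "S \<in> M l" and T: "T \<in> M l" for S T
  proof -
    have i_eq: "i (C l U V) - C l V U \<in> below l" if "U \<in> M l" "V \<in> M l" for U V
      using i_C[OF l that] .
    have "i (i a * C l T S - (\<Sum>T'\<in>M l. scale (\<rho> T' T) (C l T' S))) \<in> below l"
      using \<rho> S T by (intro i_below) blast
    then have 1: "i (C l T S) * a - (\<Sum>T'\<in>M l. scale (\<rho> T' T) (i (C l T' S))) \<in> below l"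
      by (simp add: i_diff i_sum i_scale anti_mult_i involution_i)
    have 2: "(\<Sum>T'\<in>M l. scale (\<rho> T' T) (i (C l T' S) - C l S T')) \<in> below l"
      using S by (intro subspace_sum[OF subspace_below] below_scale i_eq)
    have 3: "(i (C l T S) - C l S T) * a \<in> below l"
      using S T by (intro mult_right_below i_eq)
    from below_diff[OF below_add[OF 1 2] 3] show ?thesis
      by (simp add: scale_right_diff_distrib sum_subtractf left_diff_distrib)
  qed
  then show ?thesis by blast
qed

end

section \<open>Symmetric cellular algebras as dual pairs of bases\<close>

locale symmetric_cellular_algebra = cellular_algebra scale \<Lambda> r M C i
  for scale :: "'k::field \<Rightarrow> 'a::{ring,monoid_mult} \<Rightarrow> 'a"
    and \<Lambda> :: "'l set" and r and M :: "'l \<Rightarrow> 'm set" and C i +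
  fixes \<tau> :: "'a \<Rightarrow> 'k" and D :: "'l \<Rightarrow> 'm \<Rightarrow> 'm \<Rightarrow> 'a"
  assumes symm: "symmetrizing_trace scale \<tau>"
    and dual_D: "dual_cell_basis scale \<tau> \<Lambda> M C D"
begin

text \<open>Since \<open>\<tau> (a * b) = f a b\<close>, symmetry and nondegeneracy of the form
  become properties of \<open>\<tau>\<close> alone.\<close>

lemma trace_add: "\<tau> (x + y) = \<tau> x + \<tau> y"
  and trace_scale: "\<tau> (scale c x) = c * \<tau> x"
  and trace_commute: "\<tau> (x * y) = \<tau> (y * x)"
  and trace_nondegenerate: "(\<And>b. \<tau> (x * b) = 0) \<Longrightarrow> x = 0"
proof -
  obtain f where f: "symmetrizing_form scale f" and tau: "\<And>a. \<tau> a = f a 1"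
    using symm unfolding symmetrizing_trace_def by blast
  interpret Vector_Spaces.linear scale "(*)" "\<lambda>a. f a 1"
    using f unfolding symmetrizing_form_def by blast
  show "\<tau> (x + y) = \<tau> x + \<tau> y" "\<tau> (scale c x) = c * \<tau> x"
    unfolding tau by (rule add scale)+
  have mult: "\<tau> (a * b) = f a b" for a b
    using f unfolding symmetrizing_form_def tau by (metis mult.right_neutral)
  then show "\<tau> (x * y) = \<tau> (y * x)"
    using f unfolding symmetrizing_form_def by metis
  show "(\<And>b. \<tau> (x * b) = 0) \<Longrightarrow> x = 0"
    using f mult unfolding symmetrizing_form_def by metis
qed

lemma trace_0 [simp]: "\<tau> 0 = 0"
  using trace_scale[of 0 0] by simp

lemma trace_sum: "\<tau> (\<Sum>p\<in>P. g p) = (\<Sum>p\<in>P. \<tau> (g p))"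
  by (induction P rule: infinite_finite_induct) (simp_all add: trace_add)

lemma trace_C_D:
  "\<lbrakk>l \<in> \<Lambda>; m \<in> \<Lambda>; S \<in> M l; T \<in> M l; U \<in> M m; V \<in> M m\<rbrakk> \<Longrightarrow>
    \<tau> (C l S T * D m U V) = (if l = m \<and> S = V \<and> T = U then 1 else 0)"
  using dual_D unfolding dual_cell_basis_def by blast

lemma eq_0_if_trace_cell_basis:
  assumes B: "cell_basis scale \<Lambda> M B"
    and 0: "\<And>l S T. l \<in> \<Lambda> \<Longrightarrow> S \<in> M l \<Longrightarrow> T \<in> M l \<Longrightarrow> \<tau> (x * B l S T) = 0"
  shows "x = 0"
proof (rule trace_nondegenerate)
  fix b
  have "b \<in> span ((\<lambda>(l, S, T). B l S T) ` (SIGMA l:\<Lambda>. M l \<times> M l))"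
    using B unfolding cell_basis_def basis_family_def by simp
  then show "\<tau> (x * b) = 0"
    by (induction rule: span_induct_alt)
      (auto simp: distrib_left scale_mult_right trace_add trace_scale 0)
qed

lemma trace_below:
  assumes "x \<in> below l" "m \<in> \<Lambda>" "U \<in> M m" "V \<in> M m" "\<tau> (x * D m U V) \<noteq> 0"
  shows "(m, l) \<in> r \<and> m \<noteq> l"
proof -
  have "\<tau> (x * D m U V) \<noteq> 0 \<longrightarrow> (m, l) \<in> r \<and> m \<noteq> l"
    using assms(1)
    by (induction rule: below_induct)
      (auto simp: distrib_right trace_add scale_mult_left trace_scale trace_C_D assms split: if_splits)
  then show ?thesis using assms(5) by blast
qed

text \<open>The index functions \<open>s\<close> and \<open>t\<close> let one statement serve left
  multiplication, where the first index varies, and right multiplication, where the second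
  does.\<close>

lemma trace_congruent:
  assumes "x - (\<Sum>P\<in>M l. scale (g P) (C l (s P) (t P))) \<in> below l"
    and "l \<in> \<Lambda>" "m \<in> \<Lambda>" "U \<in> M m" "V \<in> M m" "\<And>P. P \<in> M l \<Longrightarrow> s P \<in> M l \<and> t P \<in> M l"
  shows "\<tau> (x * D m U V) \<noteq> 0 \<Longrightarrow> (m, l) \<in> r"
    and "m = l \<Longrightarrow> \<tau> (x * D m U V) = (\<Sum>P\<in>M l. if s P = V \<and> t P = U then g P else 0)"
proof -
  let ?s = "\<Sum>P\<in>M l. scale (g P) (C l (s P) (t P))"
  have "\<tau> (?s * D m U V) = (\<Sum>P\<in>M l. if l = m \<and> s P = V \<and> t P = U then g P else 0)"
    unfolding sum_distrib_right trace_sum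
    by (rule sum.cong[OF refl]) (use assms in \<open>auto simp: scale_mult_left trace_scale trace_C_D\<close>)
  moreover have "\<tau> (x * D m U V) = \<tau> ((x - ?s) * D m U V) + \<tau> (?s * D m U V)"
    by (simp flip: trace_add distrib_right)
  ultimately have eq: "\<tau> (x * D m U V) = \<tau> ((x - ?s) * D m U V) +
      (\<Sum>P\<in>M l. if l = m \<and> s P = V \<and> t P = U then g P else 0)" by simp
  have refl: "(l, l) \<in> r"
    using finite_poset(2) assms(2) unfolding partial_order_on_def preorder_on_def refl_on_def by blast
  show "\<tau> (x * D m U V) \<noteq> 0 \<Longrightarrow> (m, l) \<in> r"
    using trace_below[OF assms(1,3,4,5)] refl eq by (cases "l = m") auto
  show "m = l \<Longrightarrow> \<tau> (x * D m U V) = (\<Sum>P\<in>M l. if s P = V \<and> t P = U then g P else 0)"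
    using trace_below[OF assms(1,3,4,5)] eq by auto
qed

text \<open>This is (C3) in terms of coefficients: only indices \<open>m \<le> l\<close> occur,
  within the cell \<open>l\<close> the second index is kept, and the coefficient does not depend on
  it.\<close>

lemma trace_mult_left:
  assumes l: "l \<in> \<Lambda>" and M: "S \<in> M l" "T \<in> M l"
  shows "\<lbrakk>m \<in> \<Lambda>; U \<in> M m; V \<in> M m; \<tau> (a * C l S T * D m U V) \<noteq> 0\<rbrakk> \<Longrightarrow> (m, l) \<in> r"
    and "\<lbrakk>U \<in> M l; V \<in> M l; T \<noteq> U\<rbrakk> \<Longrightarrow> \<tau> (a * C l S T * D l U V) = 0"
    and "\<lbrakk>U \<in> M l; V \<in> M l\<rbrakk> \<Longrightarrow> \<tau> (a * C l S T * D l T V) = \<tau> (a * C l S U * D l U V)"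
proof -
  obtain \<rho> where \<rho>: "\<forall>S\<in>M l. \<forall>T\<in>M l. a * C l S T - (\<Sum>S'\<in>M l. scale (\<rho> S' S) (C l S' T)) \<in> below l"
    using mult_C[OF l] by blast
  show "(m, l) \<in> r" if "m \<in> \<Lambda>" "U \<in> M m" "V \<in> M m" "\<tau> (a * C l S T * D m U V) \<noteq> 0"
    by (rule trace_congruent(1)[OF \<rho>[rule_format]]) (use that l M in auto)
  have coeff: "\<tau> (a * C l S T * D l U V) = (if T = U then \<rho> V S else 0)"
    if "S \<in> M l" "T \<in> M l" "U \<in> M l" "V \<in> M l" for S T U V
    by (subst trace_congruent(2)[OF \<rho>[rule_format]])
      (use that l finite_M in \<open>auto simp: sum.delta\<close>)
  show "\<tau> (a * C l S T * D l U V) = 0" if "U \<in> M l" "V \<in> M l" "T \<noteq> U"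
    using that M by (simp add: coeff)
  show "\<tau> (a * C l S T * D l T V) = \<tau> (a * C l S U * D l U V)" if "U \<in> M l" "V \<in> M l"
    using that M by (simp add: coeff)
qed

lemma trace_mult_right:
  assumes l: "l \<in> \<Lambda>" and M: "S \<in> M l" "T \<in> M l"
  shows "\<lbrakk>m \<in> \<Lambda>; U \<in> M m; V \<in> M m; \<tau> (C l S T * a * D m U V) \<noteq> 0\<rbrakk> \<Longrightarrow> (m, l) \<in> r"
    and "\<lbrakk>U \<in> M l; V \<in> M l; S \<noteq> V\<rbrakk> \<Longrightarrow> \<tau> (C l S T * a * D l U V) = 0"
    and "\<lbrakk>U \<in> M l; V \<in> M l\<rbrakk> \<Longrightarrow> \<tau> (C l S T * a * D l U S) = \<tau> (C l V T * a * D l U V)"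
proof -
  obtain \<rho> where \<rho>: "\<forall>S\<in>M l. \<forall>T\<in>M l. C l S T * a - (\<Sum>T'\<in>M l. scale (\<rho> T' T) (C l S T')) \<in> below l"
    using mult_C_right[OF l] by blast
  show "(m, l) \<in> r" if "m \<in> \<Lambda>" "U \<in> M m" "V \<in> M m" "\<tau> (C l S T * a * D m U V) \<noteq> 0"
    by (rule trace_congruent(1)[OF \<rho>[rule_format]]) (use that l M in auto)
  have coeff: "\<tau> (C l S T * a * D l U V) = (if S = V then \<rho> U T else 0)"
    if "S \<in> M l" "T \<in> M l" "U \<in> M l" "V \<in> M l" for S T U V
    by (subst trace_congruent(2)[OF \<rho>[rule_format]])
      (use that l finite_M in \<open>auto simp: sum.delta\<close>)
  show "\<tau> (C l S T * a * D l U V) = 0" if "U \<in> M l" "V \<in> M l" "S \<noteq> V"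
    using that M by (simp add: coeff)
  show "\<tau> (C l S T * a * D l U S) = \<tau> (C l V T * a * D l U V)" if "U \<in> M l" "V \<in> M l"
    using that M by (simp add: coeff)
qed

lemma eq_if_trace_mult_left:
  assumes "\<And>a. \<tau> (a * x) = \<tau> (a * y)"
  shows "x = y"
proof -
  have "\<tau> ((x - y) * a) = 0" for a
    using assms[of a] trace_add[of "a * (x - y)" "a * y"]
    by (subst trace_commute) (simp add: right_diff_distrib)
  then have "x - y = 0" by (rule trace_nondegenerate)
  then show ?thesis by simp
qed

text \<open>By nondegeneracy a product is determined by its traces against all \<open>a\<close>. For
  \<open>C * D\<close> these are governed by left multiplication on \<open>C\<close>; for
  \<open>D * C\<close>, \<open>swap\<close> rotates them into traces governed by right
  multiplication.\<close>

sublocale dual_cell_bases scale \<Lambda> r M C D \<tau>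
proof unfold_locales
  show "finite \<Lambda>" "partial_order_on \<Lambda> r" by (fact finite_poset)+
  show "x = 0" if "\<And>l S T. l \<in> \<Lambda> \<Longrightarrow> S \<in> M l \<Longrightarrow> T \<in> M l \<Longrightarrow> \<tau> (x * C l S T) = 0" for x
    using eq_0_if_trace_cell_basis[OF basis_C that] by blast
  have basis_D: "cell_basis scale \<Lambda> M D"
    using dual_D unfolding dual_cell_basis_def by blast
  show "x = 0" if "\<And>l S T. l \<in> \<Lambda> \<Longrightarrow> S \<in> M l \<Longrightarrow> T \<in> M l \<Longrightarrow> \<tau> (x * D l S T) = 0" for x
    using eq_0_if_trace_cell_basis[OF basis_D that] by blast
  have swap: "\<tau> (a * (D m U V * C l S T)) = \<tau> (C l S T * a * D m U V)" for a l m S T U V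
    by (metis mult.assoc trace_commute)
  show "(m, l) \<in> r"
    if lm: "l \<in> \<Lambda>" "m \<in> \<Lambda>" "S \<in> M l" "T \<in> M l" "U \<in> M m" "V \<in> M m"
      and nz: "C l S T * D m U V \<noteq> 0" for l m S T U V
  proof -
    obtain a where a: "\<tau> (a * C l S T * D m U V) \<noteq> 0"
      using nz eq_if_trace_mult_left[of _ 0] by (auto simp: mult.assoc)
    show ?thesis
      using trace_mult_left(1)[OF lm(1,3,4,2,5,6) a] .
  qed
  show "(m, l) \<in> r"
    if lm: "m \<in> \<Lambda>" "l \<in> \<Lambda>" "U \<in> M m" "V \<in> M m" "S \<in> M l" "T \<in> M l"
      and nz: "D m U V * C l S T \<noteq> 0" for l m S T U V
  proof -
    obtain a where a: "\<tau> (C l S T * a * D m U V) \<noteq> 0"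
      using nz eq_if_trace_mult_left[of _ 0] by (auto simp flip: swap)
    show ?thesis
      using trace_mult_right(1)[OF lm(2,5,6,1,3,4) a] .
  qed
  fix l S T U V assume l: "l \<in> \<Lambda>" and M: "S \<in> M l" "T \<in> M l" "U \<in> M l" "V \<in> M l"
  show "C l S T * D l U V = 0" if "T \<noteq> U"
    using trace_mult_left(2)[OF l M that]
    by (intro eq_if_trace_mult_left) (simp add: mult.assoc)
  show "C l S T * D l T V = C l S U * D l U V"
    using trace_mult_left(3)[OF l M]
    by (intro eq_if_trace_mult_left) (simp add: mult.assoc)
  show "D l S T * C l U V = 0" if "T \<noteq> U"
    using trace_mult_right(2)[OF l M(3,4,1,2)] that
    by (intro eq_if_trace_mult_left) (simp add: swap)
  show "D l S T * C l T V = D l S U * C l U V"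
    using trace_mult_right(3)[OF l M(2,4,1,3)]
    by (intro eq_if_trace_mult_left) (simp add: swap)
qed (fact finite_M nonempty_M trace_add trace_scale trace_commute trace_C_D)+

text \<open>Applying \<open>i\<close> to the congruence of \<open>C l T T * C l U T\<close> with
  \<open>?c\<close> times \<open>C l T T\<close> gives the one for \<open>C l T U * C l T T\<close>,
  whose factor is the form with swapped arguments.\<close>

lemma cell_form_commute:
  assumes l: "l \<in> \<Lambda>" and TU: "T \<in> M l" "U \<in> M l"
  shows "cell_form scale \<Lambda> r M C l T U = cell_form scale \<Lambda> r M C l U T"
proof -
  let ?c = "cell_form scale \<Lambda> r M C l T U"
  have i_eq: "i (C l P Q) - C l Q P \<in> below l" if "P \<in> M l" "Q \<in> M l" for P Q
    using i_C[OF l that] .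
  have "C l T T * C l U T - scale ?c (C l T T) \<in> below l"
    using l TU by (simp add: C_mult_C cell_form_eq)
  then have 1: "i (C l U T) * i (C l T T) - scale ?c (i (C l T T)) \<in> below l"
    using i_below by (fastforce simp: i_diff i_scale anti_mult_i)
  \<comment> \<open>The facts \<open>2\<close>, \<open>3\<close> and \<open>4\<close> are the errors
    of replacing \<open>i (C l P Q)\<close> by \<open>C l Q P\<close>.\<close>
  have 2: "(i (C l U T) - C l T U) * i (C l T T) \<in> below l"
    using TU by (intro mult_right_below i_eq)
  have 3: "C l T U * (i (C l T T) - C l T T) \<in> below l"
    using TU by (intro mult_left_below i_eq)
  have 4: "scale ?c (i (C l T T) - C l T T) \<in> below l"
    using TU by (intro below_scale i_eq)
  have "C l T U * C l T T - scale ?c (C l T T) =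
      (i (C l U T) * i (C l T T) - scale ?c (i (C l T T))) - (i (C l U T) - C l T U) * i (C l T T)
      - C l T U * (i (C l T T) - C l T T) + scale ?c (i (C l T T) - C l T T)"
    by (simp add: algebra_simps scale_right_diff_distrib)
  then have "C l T U * C l T T - scale ?c (C l T T) \<in> below l"
    using below_add[OF below_diff[OF below_diff[OF 1 2] 3] 4] by simp
  then have "?c = \<tau> (C l T U * C l T T * D l T T)"
    using l TU by (simp add: C_mult_C)
  then show ?thesis
    using l TU by (simp add: cell_form_eq)
qed

end

theorem corollary5p1:
  fixes scale :: "'k::field \<Rightarrow> 'a::{ring,monoid_mult} \<Rightarrow> 'a"
    and \<Lambda> :: "'l set" and r :: "('l \<times> 'l) set" and M :: "'l \<Rightarrow> 'm set"
    and C D :: "'l \<Rightarrow> 'm \<Rightarrow> 'm \<Rightarrow> 'a" and i :: "'a \<Rightarrow> 'a" and \<tau> :: "'a \<Rightarrow> 'k"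
  assumes "\<exists>B. finite_dimensional_vector_space scale B"
    and "cellular_algebra scale \<Lambda> r M C i"
    and "symmetrizing_trace scale \<tau>"
    and "dual_cell_basis scale \<tau> \<Lambda> M C D"
  shows "(semisimple_algebra TYPE('a) \<longleftrightarrow>
            (\<forall>l\<in>\<Lambda>. cell_const scale \<Lambda> r M C D l \<noteq> 0)) \<and>
         (semisimple_algebra TYPE('a) \<longleftrightarrow>
            cell_basis scale \<Lambda> M (\<lambda>l S T. C l S T * D l T T)) \<and>
         (semisimple_algebra TYPE('a) \<longleftrightarrow>
            (\<forall>l\<in>\<Lambda>. \<exists>S\<in>M l. \<exists>T\<in>M l. (C l S T * D l T S)\<^sup>2 \<noteq> 0)) \<and>
         (semisimple_algebra TYPE('a) \<longleftrightarrow>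
            (\<forall>l\<in>\<Lambda>. \<forall>S\<in>M l. \<forall>T\<in>M l. (C l S T * D l T S)\<^sup>2 \<noteq> 0))"
proof -
  interpret symmetric_cellular_algebra scale \<Lambda> r M C i \<tau> D
    using assms(2-4) unfolding symmetric_cellular_algebra_def symmetric_cellular_algebra_axioms_def
    by blast
  have const: "cell_const scale \<Lambda> r M C D l = kappa l" if "l \<in> \<Lambda>" for l
    using that cell_form_commute by (intro cell_const_eq_kappa)
  have E: "(\<lambda>l S T. C l S T * D l T T) = E"
    by (intro ext) (simp add: E_def)
  \<comment> \<open>Every condition is compared with the single one that all \<open>kappa l\<close>
    are nonzero.\<close>
  have "semisimple_algebra TYPE('a) \<longleftrightarrow> (\<forall>l\<in>\<Lambda>. kappa l \<noteq> 0)"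
    using kappa_nonzero_if_semisimple semisimple_if_kappa_nonzero basis_E[OF basis_C] by blast
  moreover have "(\<forall>l\<in>\<Lambda>. kappa l \<noteq> 0) \<longleftrightarrow> cell_basis scale \<Lambda> M E"
    using kappa_nonzero_if_basis_E basis_E[OF basis_C] by blast
  moreover have "(\<forall>l\<in>\<Lambda>. kappa l \<noteq> 0) \<longleftrightarrow> (\<forall>l\<in>\<Lambda>. \<exists>S\<in>M l. \<exists>T\<in>M l. (C l S T * D l T S)\<^sup>2 \<noteq> 0)"
    using nonempty_M by (auto simp: E_square_nonzero_iff)
  moreover have "(\<forall>l\<in>\<Lambda>. kappa l \<noteq> 0) \<longleftrightarrow> (\<forall>l\<in>\<Lambda>. \<forall>S\<in>M l. \<forall>T\<in>M l. (C l S T * D l T S)\<^sup>2 \<noteq> 0)"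
    using nonempty_M by (auto simp: E_square_nonzero_iff)
  ultimately show ?thesis
    unfolding E by (simp add: const)
qed

end
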